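(* Let $f$ and $h$ be two positive continuous functions on $[1,\infty)$ such that $f\le h$ on $[1,\infty)$. If $\frac{f}{h}$ is decreasing and $f$ is increasing on $[1,\infty)$, then for any $p\ge 1$, all $x>1$, all $\alpha,\phi>0$ and all $\beta,\varphi\in(0,1]$, $$\frac{\mathcal{H}^{\alpha,\beta}_{1,x}[f(x)]\,\mathcal{H}^{\phi,\varphi}_{1,x}[h^{p}(x)]+\mathcal{H}^{\phi,\varphi}_{1,x}[f(x)]\,\mathcal{H}^{\alpha,\beta}_{1,x}[h^{p}(x)]}{\mathcal{H}^{\alpha,\beta}_{1,x}[h(x)]\,\mathcal{H}^{\phi,\varphi}_{1,x}[f^{p}(x)]+\mathcal{H}^{\phi,\varphi}_{1,x}[h(x)]\,\mathcal{H}^{\alpha,\beta}_{1,x}[f^{p}(x)]}\ge 1.$$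
   Context: For $\alpha>0$, $\beta\in(0,1]$ and $x>1$, the one-sided generalized proportional Hadamard fractional integral of a function $z$ on $[1,\infty)$ is $$\mathcal{H}^{\alpha,\beta}_{1,x}[z(x)]=(\mathcal{H}^{\alpha,\beta}_{1,x}z)(x)=\frac{1}{\beta^{\alpha}\Gamma(\alpha)}\int_{1}^{x}e^{\frac{\beta-1}{\beta}(\ln x-\ln t)}(\ln x-\ln t)^{\alpha-1}\frac{z(t)}{t}\,dt,$$ where $\Gamma$ is the gamma function; $\mathcal{H}^{\phi,\varphi}_{1,x}$ is the same operator with order $\phi$ and proportionality index $\varphi$. "Increasing" and "decreasing" are in the non-strict sense; $f^p(x)$ means $(f(x))^p$. *)

theory Defs
  imports "HOL-Analysis.Analysis"
begin

(* Generalized proportional Hadamard fractional integral with base point 1, of order \<alpha> and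
   proportionality index \<beta>.  The functions of the theory live on [1, \<infinity>); here they are
   total, but for x > 1 only values on [1, x] enter.  At t = x the kernel factor is
   "0 powr (\<alpha> - 1)", which is 0 by convention; this is a single point, hence irrelevant
   to the integral. *)
definition prop_hadamard_integral ::
    "real \<Rightarrow> real \<Rightarrow> (real \<Rightarrow> real) \<Rightarrow> real \<Rightarrow> real" where
  "prop_hadamard_integral \<alpha> \<beta> z x =
     1 / (\<beta> powr \<alpha> * Gamma \<alpha>) *
     (LBINT t:{1..x}. exp ((\<beta> - 1) / \<beta> * (ln x - ln t)) * (ln x - ln t) powr (\<alpha> - 1) * (z t / t))"

end

theory Submission
  imports Defs
begin

text \<open>
  Up to a positive factor, the numerator minus the denominator is the double integral, against the
  product of the two kernels (one in \<open>s\<close>, the other in \<open>t\<close>), of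
  \<open>f(s) h(t)\<^sup>p + f(t) h(s)\<^sup>p - h(s) f(t)\<^sup>p - h(t) f(s)\<^sup>p\<close>,
  and this integrand is nonnegative at every pair of points (\<open>ratio_power_exchange\<close>).  Indeed
  \<open>f \<le> h\<close> gives \<open>h\<^sup>p \<ge> h f\<^sup>p\<^sup>-\<^sup>1\<close>; after this replacement the expression factors as
  \<open>(f(t)\<^sup>p\<^sup>-\<^sup>1 - f(s)\<^sup>p\<^sup>-\<^sup>1) (f(s) h(t) - f(t) h(s))\<close>,
  whose factors have the same sign because \<open>f\<close> increases while \<open>f / h\<close> decreases.

  Every term of the integrand is a function of \<open>s\<close> times a function of \<open>t\<close>, so the double integral
  can be carried out as two successive single integrations, without Fubini's theorem
  (\<open>weighted_integral_exchange\<close>).  It remains to see that the integrals converge, which for orders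
  below 1 rests on the explicit primitive of the singular part of the kernel
  (\<open>set_integrable_log_power\<close>), and that the denominator is strictly positive, so that the
  inequality may be divided by it.
\<close>

section \<open>A pointwise exchange inequality\<close>

text \<open>
  The case \<open>s \<le> t\<close> suffices, since the inequality is symmetric in the two points; here \<open>a, b\<close> are
  the values of \<open>f, h\<close> at the earlier point and \<open>c, d\<close> those at the later one.
\<close>

lemma ratio_power_exchange_ordered:
  fixes a b c d p :: real
  assumes pos: "0 < a" "0 < b" "0 < c" "0 < d" and le: "a \<le> b" "c \<le> d"
    and ac: "a \<le> c" and ratio: "c / d \<le> a / b" and p: "1 \<le> p"
  shows "b * c powr p + d * a powr p \<le> a * d powr p + c * b powr p"
proof -
  have split: "y powr p = y * y powr (p - 1)" if "0 < y" for y :: real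
    using that by (simp add: powr_mult_base)
  have mono: "a powr (p - 1) \<le> c powr (p - 1)"
    "c powr (p - 1) \<le> d powr (p - 1)" "a powr (p - 1) \<le> b powr (p - 1)"
    using pos le ac p by (auto intro: powr_mono2)
  have cross: "c * b \<le> a * d"
    using ratio pos by (simp add: field_simps)
  have "0 \<le> (c powr (p - 1) - a powr (p - 1)) * (a * d - c * b)"
    using mono cross by simp
  then have "b * (c * c powr (p - 1)) + d * (a * a powr (p - 1))
      \<le> a * (d * c powr (p - 1)) + c * (b * a powr (p - 1))"
    by (simp add: algebra_simps)
  also have "\<dots> \<le> a * (d * d powr (p - 1)) + c * (b * b powr (p - 1))"
    using mono pos by (intro add_mono mult_left_mono) auto
  finally show ?thesis
    using pos by (simp add: split)
qed

lemma ratio_power_exchange: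
  fixes f h :: "real \<Rightarrow> real"
  assumes pos: "\<And>t. t \<in> A \<Longrightarrow> 0 < f t" "\<And>t. t \<in> A \<Longrightarrow> 0 < h t"
    and le: "\<And>t. t \<in> A \<Longrightarrow> f t \<le> h t"
    and anti: "antimono_on A (\<lambda>t. f t / h t)" and mono: "mono_on A f"
    and p: "1 \<le> p" and st: "s \<in> A" "t \<in> A"
  shows "h s * f t powr p + h t * f s powr p \<le> f s * h t powr p + f t * h s powr p"
proof -
  have ordered: "h r * f q powr p + h q * f r powr p \<le> f r * h q powr p + f q * h r powr p"
    if "r \<in> A" "q \<in> A" "r \<le> q" for r q
    using that pos le monotone_onD[OF anti, of r q] monotone_onD[OF mono, of r q] p
    by (intro ratio_power_exchange_ordered) auto
  show ?thesis
    using ordered[of s t] ordered[of t s] st by (cases "s \<le> t") auto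
qed

section \<open>Integrating an exchange inequality\<close>

text \<open>
  For a fixed \<open>s\<close> the hypothesis is integrated in \<open>t\<close> against \<open>v\<close>; the result is an inequality
  between linear combinations of \<open>a s\<close>, \<open>b s\<close>, \<open>c s\<close>, \<open>d s\<close>, which is then integrated in \<open>s\<close>
  against \<open>u\<close>.
\<close>

lemma weighted_integral_exchange:
  fixes u v a b c d :: "'a \<Rightarrow> real"
  assumes u: "\<And>t. t \<in> A \<Longrightarrow> 0 \<le> u t" and v: "\<And>t. t \<in> A \<Longrightarrow> 0 \<le> v t"
    and exch: "\<And>s t. s \<in> A \<Longrightarrow> t \<in> A \<Longrightarrow>
      c s * d t + c t * d s \<le> a s * b t + a t * b s"
    and iu: "\<And>g. g \<in> {a, b, c, d} \<Longrightarrow> set_integrable M A (\<lambda>t. u t * g t)"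
    and iv: "\<And>g. g \<in> {a, b, c, d} \<Longrightarrow> set_integrable M A (\<lambda>t. v t * g t)"
  shows "(LINT t:A|M. u t * c t) * (LINT t:A|M. v t * d t)
       + (LINT t:A|M. v t * c t) * (LINT t:A|M. u t * d t)
    \<le> (LINT t:A|M. u t * a t) * (LINT t:A|M. v t * b t)
       + (LINT t:A|M. v t * a t) * (LINT t:A|M. u t * b t)"
proof -
  define U where "U g = (LINT t:A|M. u t * g t)" for g
  define V where "V g = (LINT t:A|M. v t * g t)" for g
  have V_lin: "(LINT t:A|M. k * (v t * g t) + l * (v t * g' t)) = k * V g + l * V g'"
    "set_integrable M A (\<lambda>t. k * (v t * g t) + l * (v t * g' t))"
    if "g \<in> {a, b, c, d}" "g' \<in> {a, b, c, d}" for g g' k l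
    using iv[OF that(1)] iv[OF that(2)] by (simp_all add: V_def set_integral_add(2))
  have U_lin: "(LINT t:A|M. k * (u t * g t) + l * (u t * g' t)) = k * U g + l * U g'"
    "set_integrable M A (\<lambda>t. k * (u t * g t) + l * (u t * g' t))"
    if "g \<in> {a, b, c, d}" "g' \<in> {a, b, c, d}" for g g' k l
    using iu[OF that(1)] iu[OF that(2)] by (simp_all add: U_def set_integral_add(2))
  have inner: "c s * V d + d s * V c \<le> a s * V b + b s * V a" if s: "s \<in> A" for s
  proof -
    have "(LINT t:A|M. c s * (v t * d t) + d s * (v t * c t))
        \<le> (LINT t:A|M. a s * (v t * b t) + b s * (v t * a t))"
    proof (rule set_integral_mono)
      fix t assume t: "t \<in> A"
      have "v t * (c s * d t + c t * d s) \<le> v t * (a s * b t + a t * b s)"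
        using exch[OF s t] v[OF t] by (rule mult_left_mono)
      then show "c s * (v t * d t) + d s * (v t * c t) \<le> a s * (v t * b t) + b s * (v t * a t)"
        by (simp add: algebra_simps)
    qed (auto intro!: V_lin(2))
    then show ?thesis by (simp add: V_lin(1))
  qed
  have "(LINT s:A|M. V d * (u s * c s) + V c * (u s * d s))
      \<le> (LINT s:A|M. V b * (u s * a s) + V a * (u s * b s))"
  proof (rule set_integral_mono)
    fix s assume s: "s \<in> A"
    have "u s * (c s * V d + d s * V c) \<le> u s * (a s * V b + b s * V a)"
      using inner[OF s] u[OF s] by (rule mult_left_mono)
    then show "V d * (u s * c s) + V c * (u s * d s) \<le> V b * (u s * a s) + V a * (u s * b s)"
      by (simp add: algebra_simps)
  qed (auto intro!: U_lin(2))
  then have "V d * U c + V c * U d \<le> V b * U a + V a * U b"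
    by (simp add: U_lin(1))
  then show ?thesis
    unfolding U_def V_def by (simp add: mult.commute)
qed

section \<open>The proportional Hadamard kernel\<close>

text \<open>
  For \<open>\<alpha> < 1\<close> the function is unbounded near \<open>x\<close>, but \<open>- ((ln x - ln t) powr \<alpha> / \<alpha>)\<close> is a primitive
  that is continuous up to the endpoint, and a nonnegative derivative of such a function is
  absolutely integrable.
\<close>

lemma set_integrable_log_power:
  fixes \<alpha> x :: real
  assumes \<alpha>: "0 < \<alpha>" and x: "1 < x"
  shows "set_integrable lborel {1..x} (\<lambda>t. (ln x - ln t) powr (\<alpha> - 1) / t)"
proof -
  let ?g = "\<lambda>t. (ln x - ln t) powr (\<alpha> - 1) / t"
  let ?G = "\<lambda>t. - ((ln x - ln t) powr \<alpha> / \<alpha>)"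
  have cont: "continuous_on {1..x} ?G"
    using \<alpha> by (intro continuous_intros continuous_on_powr') auto
  have deriv: "(?G has_vector_derivative ?g t) (at t)" if "t \<in> {1<..<x}" for t
  proof -
    have "(?G has_real_derivative ?g t) (at t)"
      using that \<alpha> by (auto intro!: derivative_eq_intros simp: field_simps)
    then show ?thesis by (simp add: has_real_derivative_iff_has_vector_derivative)
  qed
  have "(?g has_integral (?G x - ?G 1)) {1..x}"
    using fundamental_theorem_of_calculus_interior[OF _ cont deriv] x by auto
  then have "?g integrable_on {1..x}" by blast
  then have "?g absolutely_integrable_on {1..x}"
    by (rule nonnegative_absolutely_integrable_1) auto
  moreover have "(\<lambda>t. indicator {1..x} t *\<^sub>R ?g t) \<in> borel_measurable lborel"
    by measurable
  ultimately show ?thesis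
    unfolding set_integrable_def by (subst (asm) integrable_completion) auto
qed

definition hadamard_kernel :: "real \<Rightarrow> real \<Rightarrow> real \<Rightarrow> real \<Rightarrow> real" where
  "hadamard_kernel \<alpha> \<beta> x t =
     exp ((\<beta> - 1) / \<beta> * (ln x - ln t)) * ((ln x - ln t) powr (\<alpha> - 1) / t)"

lemma prop_hadamard_integral_eq_kernel:
  "prop_hadamard_integral \<alpha> \<beta> z x =
     1 / (\<beta> powr \<alpha> * Gamma \<alpha>) * (LBINT t:{1..x}. hadamard_kernel \<alpha> \<beta> x t * z t)"
  unfolding prop_hadamard_integral_def hadamard_kernel_def by (simp add: mult.assoc)

lemma hadamard_kernel_nonneg: "1 \<le> t \<Longrightarrow> 0 \<le> hadamard_kernel \<alpha> \<beta> x t"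
  by (simp add: hadamard_kernel_def)

lemma hadamard_kernel_pos: "1 < t \<Longrightarrow> t < x \<Longrightarrow> 0 < hadamard_kernel \<alpha> \<beta> x t"
  by (simp add: hadamard_kernel_def)

text \<open>
  The exponential factor and \<open>z\<close> are continuous, hence bounded, on the compact interval, so the
  singular part of the kernel dominates up to a constant.
\<close>

lemma set_integrable_hadamard_kernel_times:
  fixes \<alpha> \<beta> x :: real
  assumes \<alpha>: "0 < \<alpha>" and x: "1 < x" and z: "continuous_on {1..x} z"
  shows "set_integrable lborel {1..x} (\<lambda>t. hadamard_kernel \<alpha> \<beta> x t * z t)"
proof -
  let ?e = "\<lambda>t. exp ((\<beta> - 1) / \<beta> * (ln x - ln t)) * z t"
  let ?g = "\<lambda>t. (ln x - ln t) powr (\<alpha> - 1) / t"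
  have e: "continuous_on {1..x} ?e"
    using z by (intro continuous_intros) auto
  have "bounded (?e ` {1..x})"
    by (intro compact_imp_bounded compact_continuous_image e) simp
  then obtain B where "\<forall>y\<in>?e ` {1..x}. norm y \<le> B"
    unfolding bounded_iff by blast
  then have B: "\<bar>?e t\<bar> \<le> B" if "t \<in> {1..x}" for t
    using that by (metis imageI real_norm_def)
  have meas: "(\<lambda>t. indicator {1..x} t *\<^sub>R ?e t) \<in> borel_measurable lborel"
    using borel_measurable_continuous_on_indicator[OF _ e] by simp
  have "set_integrable lborel {1..x} (\<lambda>t. ?g t * ?e t)"
    unfolding set_integrable_def
  proof (rule Bochner_Integration.integrable_bound)
    show "integrable lborel (\<lambda>t. B * (indicator {1..x} t *\<^sub>R ?g t))"
      using set_integrable_log_power[OF \<alpha> x] unfolding set_integrable_def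
      by (rule integrable_mult_right)
    have "(\<lambda>t. (indicator {1..x} t *\<^sub>R ?e t) * ?g t) \<in> borel_measurable lborel"
      using meas by measurable
    then show "(\<lambda>t. indicator {1..x} t *\<^sub>R (?g t * ?e t)) \<in> borel_measurable lborel"
      by (simp add: ac_simps)
    show "AE t in lborel. norm (indicator {1..x} t *\<^sub>R (?g t * ?e t))
        \<le> norm (B * (indicator {1..x} t *\<^sub>R ?g t))"
    proof (rule AE_I2)
      fix t :: real
      have "norm (?g t * ?e t) \<le> norm (B * ?g t)" if "t \<in> {1..x}"
      proof -
        have "\<bar>?e t\<bar> * \<bar>?g t\<bar> \<le> \<bar>B\<bar> * \<bar>?g t\<bar>"
          using B[OF that] by (intro mult_right_mono) auto
        then show ?thesis
          by (simp only: real_norm_def abs_mult mult.commute[of "\<bar>?g t\<bar>"])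
      qed
      then show "norm (indicator {1..x} t *\<^sub>R (?g t * ?e t))
          \<le> norm (B * (indicator {1..x} t *\<^sub>R ?g t))"
        by (cases "t \<in> {1..x}") (simp_all only: indicator_simps not_False_eq_True
            scaleR_one scaleR_zero_left mult_zero_right norm_zero order_refl)
    qed
  qed
  then show ?thesis
    by (simp add: hadamard_kernel_def ac_simps)
qed

text \<open>
  A nonnegative function with vanishing integral is zero almost everywhere, whereas the kernel times
  \<open>z\<close> is positive on the open interval from 1 to \<open>x\<close>.
\<close>

lemma hadamard_kernel_integral_pos:
  fixes \<alpha> \<beta> x :: real
  assumes \<alpha>: "0 < \<alpha>" and x: "1 < x" and z: "continuous_on {1..x} z"
    and pos: "\<And>t. t \<in> {1..x} \<Longrightarrow> 0 < z t"
  shows "0 < (LBINT t:{1..x}. hadamard_kernel \<alpha> \<beta> x t * z t)"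
proof (rule ccontr)
  let ?F = "\<lambda>t. indicator {1..x} t *\<^sub>R (hadamard_kernel \<alpha> \<beta> x t * z t)"
  have int: "integrable lborel ?F"
    using set_integrable_hadamard_kernel_times[OF \<alpha> x z] unfolding set_integrable_def .
  have nn: "0 \<le> ?F t" for t
    using pos[of t] by (auto simp: indicator_def hadamard_kernel_nonneg less_imp_le)
  assume "\<not> ?thesis"
  then have "integral\<^sup>L lborel ?F = 0"
    using nn Bochner_Integration.integral_nonneg[of lborel ?F]
    unfolding set_lebesgue_integral_def by fastforce
  then have "AE t in lborel. ?F t = 0"
    using integral_nonneg_eq_0_iff_AE[OF int] nn by simp
  then have "AE t in lborel. t \<notin> {1<..<x}"
  proof eventually_elim
    case (elim t)
    show ?case
    proof
      assume t: "t \<in> {1<..<x}"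
      then have "0 < hadamard_kernel \<alpha> \<beta> x t * z t"
        using pos[of t] by (intro mult_pos_pos hadamard_kernel_pos) auto
      then show False using elim t by (auto simp: indicator_def)
    qed
  qed
  then have "emeasure lborel {1<..<x} = 0"
    by (subst (asm) AE_iff_measurable[of "{1<..<x}"]) auto
  then show False using x by simp
qed

section \<open>The comparison of fractional integrals\<close>

theorem theorem4p8:
  fixes f h :: "real \<Rightarrow> real" and p x \<alpha> \<beta> \<phi> \<psi> :: real
  assumes "continuous_on {1..} f" and "continuous_on {1..} h"
    and "\<And>t. t \<ge> 1 \<Longrightarrow> f t > 0" and "\<And>t. t \<ge> 1 \<Longrightarrow> h t > 0"
    and "\<And>t. t \<ge> 1 \<Longrightarrow> f t \<le> h t"
    and "antimono_on {1..} (\<lambda>t. f t / h t)"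
    and "mono_on {1..} f"
    and "p \<ge> 1" and "x > 1"
    and "\<alpha> > 0" and "\<phi> > 0"
    and "\<beta> \<in> {0<..1}" and "\<psi> \<in> {0<..1}"
  shows "(prop_hadamard_integral \<alpha> \<beta> f x * prop_hadamard_integral \<phi> \<psi> (\<lambda>t. h t powr p) x
          + prop_hadamard_integral \<phi> \<psi> f x * prop_hadamard_integral \<alpha> \<beta> (\<lambda>t. h t powr p) x)
       / (prop_hadamard_integral \<alpha> \<beta> h x * prop_hadamard_integral \<phi> \<psi> (\<lambda>t. f t powr p) x
          + prop_hadamard_integral \<phi> \<psi> h x * prop_hadamard_integral \<alpha> \<beta> (\<lambda>t. f t powr p) x) \<ge> 1"
proof -
  let ?A = "{1..x}"
  let ?U = "\<lambda>z. LBINT t:?A. hadamard_kernel \<alpha> \<beta> x t * z t"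
  let ?V = "\<lambda>z. LBINT t:?A. hadamard_kernel \<phi> \<psi> x t * z t"
  let ?fp = "\<lambda>t. f t powr p" and ?hp = "\<lambda>t. h t powr p"
  have sub: "?A \<subseteq> {1..}" by auto
  have cont: "continuous_on ?A f" "continuous_on ?A h"
    using assms(1,2) continuous_on_subset[OF _ sub] by auto
  have pos: "0 < f t" "0 < h t" if "t \<in> ?A" for t
    using assms(3,4) that by auto
  have contp: "continuous_on ?A ?fp" "continuous_on ?A ?hp"
    using pos by (fastforce intro!: continuous_on_powr cont continuous_on_const)+
  have main: "?U h * ?V ?fp + ?V h * ?U ?fp \<le> ?U f * ?V ?hp + ?V f * ?U ?hp"
  proof (rule weighted_integral_exchange)
    fix s t assume st: "s \<in> ?A" "t \<in> ?A"
    show "h s * f t powr p + h t * f s powr p \<le> f s * h t powr p + f t * h s powr p"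
      using ratio_power_exchange[OF assms(3,4,5,6,7,8)] st by auto
  qed (use cont contp assms(9,10,11) in
      \<open>auto intro!: set_integrable_hadamard_kernel_times hadamard_kernel_nonneg\<close>)
  have denpos: "0 < ?U h * ?V ?fp + ?V h * ?U ?fp"
    using pos assms(9,10,11) cont contp
    by (intro add_pos_pos mult_pos_pos hadamard_kernel_integral_pos)
      (auto simp: less_imp_neq[symmetric])
  define N where "N = 1 / (\<beta> powr \<alpha> * Gamma \<alpha>) * (1 / (\<psi> powr \<phi> * Gamma \<phi>))"
  have N: "0 < N"
    using assms(10-13) by (simp add: N_def Gamma_real_pos)
  have num: "prop_hadamard_integral \<alpha> \<beta> z x * prop_hadamard_integral \<phi> \<psi> w x
      + prop_hadamard_integral \<phi> \<psi> z x * prop_hadamard_integral \<alpha> \<beta> w x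
      = N * (?U z * ?V w + ?V z * ?U w)" for z w
    unfolding prop_hadamard_integral_eq_kernel N_def by (simp add: algebra_simps)
  show ?thesis
    unfolding num using main denpos N by simp
qed

end
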